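(* Let $b_1,b_2>0$, $b_1\neq b_2$, and let $(n_1,n_2)\in\mathbb N_0^2$. Let $C^{(1)}_{(n_1,n_2)},C^{(2)}_{(n_1,n_2)}$ be the Charlier multiple orthogonal polynomials of type I (for the weights $\omega_a(k)=\frac{b_a^k}{\Gamma(k+1)}$, $k\in\mathbb N_0$, $a\in\{1,2\}$) biorthogonal to the monic Charlier polynomials of type II. Then, for $a\in\{1,2\}$, $$C^{(a)}_{(n_1,n_2)}(x)=\frac{(-1)^{n_a-1}(n_1+n_2-2)!}{(n_1-1)!\,(n_2-1)!}\frac{e^{-b_a}}{(b_a-\hat b_a)^{n_1+n_2-1}}\;F^{1:1;0}_{1:0;0}\left[{(-n_a+1):(-x);--\atop(-n_1-n_2+2):--;--}\Bigg|\frac{b_a-\hat b_a}{b_a},\,b_a-\hat b_a\right]$$ $$=\frac{(-1)^{n_a-1}(n_1+n_2-2)!}{(n_1-1)!\,(n_2-1)!}\frac{e^{-b_a}}{(b_a-\hat b_a)^{n_1+n_2-1}}\sum_{l=0}^{n_a-1}\sum_{m=0}^{n_a-1-l}\frac{(-n_a+1)_{l+m}\,(-x)_l}{l!\,m!\,(-n_1-n_2+2)_{l+m}}\left(\frac{b_a-\hat b_a}{b_a}\right)^l(b_a-\hat b_a)^m.$$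
   Context: Pochhammer symbol: $(x)_0=1$, $(x)_n=x(x+1)\cdots(x+n-1)$. Notation: $\hat b_1=b_2$, $\hat b_2=b_1$. The type II polynomial $C_{(m_1,m_2)}$, $(m_1,m_2)\in\mathbb N_0^2$, is the monic polynomial of degree $m_1+m_2$ with $\sum_{k=0}^\infty(-k)_jC_{(m_1,m_2)}(k)\,\omega_a(k)=0$ for $j\in\{0,\dots,m_a-1\}$, $a\in\{1,2\}$. The type I polynomials biorthogonal to them have $\deg C^{(a)}_{(n_1,n_2)}\le n_a-1$ and satisfy $$\sum_{k=0}^\infty(-k)_j\big(C^{(1)}_{(n_1,n_2)}(k)\omega_1(k)+C^{(2)}_{(n_1,n_2)}(k)\omega_2(k)\big)=0,\quad j\in\{0,\dots,n_1+n_2-2\},$$ and $$\sum_{k=0}^\infty C_{(m_1,m_2)}(k)\big(C^{(1)}_{(n_1,n_2)}(k)\omega_1(k)+C^{(2)}_{(n_1,n_2)}(k)\omega_2(k)\big)=\begin{cases}0,&n_1\le m_1,\ n_2\le m_2,\\1,&m_1+m_2=n_1+n_2-1,\\0,&m_1+m_2\le n_1+n_2-2.\end{cases}$$ Kampé de Fériet series: $$F^{p:r;s}_{q:n;t}\left[{(a_i):(b_i);(d_i)\atop(\alpha_i):(\beta_i);(\gamma_i)}\Bigg|x,y\right]=\sum_{l,m\ge0}\frac{\prod_i(a_i)_{l+m}}{\prod_i(\alpha_i)_{l+m}}\frac{\prod_i(b_i)_l}{\prod_i(\beta_i)_l}\frac{\prod_i(d_i)_m}{\prod_i(\gamma_i)_m}\frac{x^l}{l!}\frac{y^m}{m!},$$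 "$--$" denoting an empty list.
   Formalization: If n_1 or n_2 is 0 the displayed formulas contain (-1)! (and possibly a zero denominator) and are undefined; they are stated literally for n_1,n_2≥1, while for n_a=0 the claim is C^{(a)}=0, and if only the other index is 0 it is the limit as that index, made real, tends to 0. *)

theory Defs
  imports "HOL-Analysis.Analysis"
begin

text \<open>
  Pairs such as $(b_1,b_2)$ and $(n_1,n_2)$ are functions on \<^typ>\<open>nat\<close>, of which only the values
  at 1 and 2 are used.
\<close>

definition hat :: "nat \<Rightarrow> nat" where
  "hat a = (if a = 1 then 2 else 1)"

definition charlier_weight :: "real \<Rightarrow> nat \<Rightarrow> real" where
  "charlier_weight b k = b ^ k / Gamma (real k + 1)"

definition charlier_type_II :: "(nat \<Rightarrow> real) \<Rightarrow> nat \<Rightarrow> nat \<Rightarrow> real poly \<Rightarrow> bool" where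
  "charlier_type_II b m1 m2 P \<longleftrightarrow>
     lead_coeff P = 1 \<and> degree P = m1 + m2 \<and>
     (\<forall>j<m1. (\<lambda>k. pochhammer (- real k) j * poly P (real k) * charlier_weight (b 1) k) sums 0) \<and>
     (\<forall>j<m2. (\<lambda>k. pochhammer (- real k) j * poly P (real k) * charlier_weight (b 2) k) sums 0)"

definition type_I_form :: "(nat \<Rightarrow> real) \<Rightarrow> (nat \<Rightarrow> real poly) \<Rightarrow> nat \<Rightarrow> real" where
  "type_I_form b C k =
     poly (C 1) (real k) * charlier_weight (b 1) k + poly (C 2) (real k) * charlier_weight (b 2) k"

text \<open>
  The degree bound $\deg C^{(a)} \le n_a - 1$ means $C^{(a)} = 0$ if $n_a = 0$. The index ranges
  $j \le n_1+n_2-2$, $m_1+m_2 = n_1+n_2-1$ and $m_1+m_2 \le n_1+n_2-2$ are written without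
  subtraction, so that they are empty when the right-hand side is negative.
\<close>

definition charlier_type_I ::
  "(nat \<Rightarrow> real) \<Rightarrow> (nat \<Rightarrow> nat \<Rightarrow> real poly) \<Rightarrow> (nat \<Rightarrow> nat) \<Rightarrow> (nat \<Rightarrow> real poly) \<Rightarrow> bool" where
  "charlier_type_I b CII n C \<longleftrightarrow>
     (\<forall>a\<in>{1, 2}. C a = 0 \<or> degree (C a) < n a) \<and>
     (\<forall>j. j + 2 \<le> n 1 + n 2 \<longrightarrow>
        (\<lambda>k. pochhammer (- real k) j * type_I_form b C k) sums 0) \<and>
     (\<forall>m1 m2.
        (n 1 \<le> m1 \<and> n 2 \<le> m2 \<longrightarrow>
           (\<lambda>k. poly (CII m1 m2) (real k) * type_I_form b C k) sums 0) \<and>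
        (m1 + m2 + 1 = n 1 + n 2 \<longrightarrow>
           (\<lambda>k. poly (CII m1 m2) (real k) * type_I_form b C k) sums 1) \<and>
        (m1 + m2 + 2 \<le> n 1 + n 2 \<longrightarrow>
           (\<lambda>k. poly (CII m1 m2) (real k) * type_I_form b C k) sums 0))"

definition pochhammers :: "'a::real_normed_field list \<Rightarrow> nat \<Rightarrow> 'a" where
  "pochhammers as k = prod_list (map (\<lambda>a. pochhammer a k) as)"

text \<open>
  Since \<^term>\<open>x / 0 = (0 :: real)\<close>, a term in which a numerator and a denominator Pochhammer symbol
  both vanish counts as 0: a series terminated by a nonpositive integer numerator parameter stays
  terminated if a denominator parameter is a smaller or equal nonpositive integer.
\<close>

definition kampe_de_feriet ::
  "'a::real_normed_field list \<Rightarrow> 'a list \<Rightarrow> 'a list \<Rightarrow> 'a list \<Rightarrow> 'a list \<Rightarrow> 'a list \<Rightarrow> 'a \<Rightarrow> 'a \<Rightarrow> 'a" where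
  "kampe_de_feriet as bs ds \<alpha>s \<beta>s \<gamma>s x y =
     (\<Sum>\<^sub>\<infinity>(l, m)\<in>UNIV.
        pochhammers as (l + m) / pochhammers \<alpha>s (l + m) *
        (pochhammers bs l / pochhammers \<beta>s l) *
        (pochhammers ds m / pochhammers \<gamma>s m) *
        (x ^ l / fact l) * (y ^ m / fact m))"

end

theory Submission
  imports Defs
begin

text \<open>
  Expand \<open>C\<^sub>a = \<Sum>\<^sub>j q\<^sub>a\<^sub>,\<^sub>j K\<^sub>j\<close> in the rescaled Charlier polynomials \<open>K\<^sub>j\<close> for the weight with
  parameter \<open>b\<^sub>a\<close>. Their factorial moments are \<open>exp b (i choose j) b^(i-j)\<close>, so the exponential
  generating function of the factorial moments of the type I form is
  \<open>A\<^sub>1(t) exp(b\<^sub>1 t) + A\<^sub>2(t) exp(b\<^sub>2 t)\<close>, where \<open>A\<^sub>a\<close> is a polynomial of degree less than \<open>n\<^sub>a\<close> with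
  coefficients \<open>exp(b\<^sub>a) q\<^sub>a\<^sub>,\<^sub>j / j!\<close>. The biorthogonality says that this function equals
  \<open>t^(N-1)/(N-1)! + O(t^N)\<close> with \<open>N = n\<^sub>1 + n\<^sub>2\<close>: a Hermite-Pade problem for two exponentials. The
  operator \<open>(D - b\<^sub>2)^n\<^sub>2\<close> kills the second summand and leaves
  \<open>(D + b\<^sub>1 - b\<^sub>2)^n\<^sub>2 A\<^sub>1 = t^(n\<^sub>1-1)/(n\<^sub>1-1)!\<close>, which determines \<open>A\<^sub>1\<close> by the binomial series.
  The case \<open>n\<^sub>2 = 0\<close> is included.
\<close>

subsection \<open>Expansion of polynomials\<close>

lemma poly_pochhammer_uminus:
  "poly (pochhammer [:0, -1:] l) x = pochhammer (- x) l" for x :: "'a :: comm_ring_1"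
  by (induction l) (simp_all add: pochhammer_Suc algebra_simps)

lemma degree_lead_coeff_pochhammer_uminus:
  "degree (pochhammer [:0, -1 :: 'a :: idom:] l) = l \<and> lead_coeff (pochhammer [:0, -1 :: 'a:] l) = (-1) ^ l"
proof (induction l)
  case (Suc l)
  have eq: "[:0, -1:] + of_nat l = [:of_nat l, -1 :: 'a:]"
    by (simp add: of_nat_poly)
  have nz: "pochhammer [:0, -1 :: 'a:] l \<noteq> 0"
  proof
    assume "pochhammer [:0, -1 :: 'a:] l = 0"
    then have "lead_coeff (pochhammer [:0, -1 :: 'a:] l) = 0" by simp
    with Suc show False by simp
  qed
  have "degree (pochhammer [:0, -1 :: 'a:] (Suc l)) = Suc l"
    unfolding pochhammer_Suc eq using Suc nz by (subst degree_mult_eq) auto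
  moreover have "lead_coeff (pochhammer [:0, -1 :: 'a:] (Suc l)) = (-1) ^ Suc l"
    unfolding pochhammer_Suc eq lead_coeff_mult Suc[THEN conjunct2] by simp
  ultimately show ?case by simp
qed simp

text \<open>Subtracting the multiple of \<open>B n\<close> that cancels the coefficient of degree
  \<open>n\<close> lowers the degree bound. Used for the Charlier polynomials and for the Pochhammer
  polynomials.\<close>

lemma poly_expand_in_graded_basis:
  fixes B :: "nat \<Rightarrow> 'a :: field poly"
  assumes deg: "\<And>j. degree (B j) = j" and nz: "\<And>j. B j \<noteq> 0"
  assumes "p = 0 \<or> degree p < n"
  shows "\<exists>c. p = (\<Sum>j<n. smult (c j) (B j))"
  using assms(3)
proof (induction n arbitrary: p)
  case (Suc n)
  define t where "t = coeff p n / lead_coeff (B n)"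
  have "coeff (p - smult t (B n)) i = 0" if "i \<ge> n" for i
  proof (cases "i = n")
    case True
    moreover have "coeff (B n) n \<noteq> 0" using nz[of n] deg[of n] by (metis leading_coeff_0_iff)
    ultimately show ?thesis using deg[of n] by (simp add: t_def)
  next
    case False
    with that Suc.prems show ?thesis using deg[of n]
      by (auto simp: coeff_eq_0)
  qed
  hence "p - smult t (B n) = 0 \<or> degree (p - smult t (B n)) < n"
    by (metis leading_coeff_0_iff not_le)
  from Suc.IH[OF this] obtain c where c: "p - smult t (B n) = (\<Sum>j<n. smult (c j) (B j))"
    by blast
  have "p = (\<Sum>j<Suc n. smult ((c(n := t)) j) (B j))"
    using c by (simp add: algebra_simps)
  then show ?case by blast
qed simp

subsection \<open>Moments of the Charlier weight\<close>

lemma charlier_weight_eq: "charlier_weight b k = b ^ k / fact k"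
  by (simp add: charlier_weight_def Gamma_fact add.commute)

lemma charlier_weight_sums: "charlier_weight b sums exp b"
  using exp_converges[of b] by (simp add: charlier_weight_eq[abs_def] field_simps)

text \<open>Rests on \<open>k * b^k / k! = b * b^(k-1) / (k-1)!\<close>; the factor \<open>k\<close>
  removes the term at 0, so the index shift loses nothing.\<close>

lemma sums_charlier_weight_shift:
  assumes "(\<lambda>k. f (Suc k) * charlier_weight b k) sums s"
  shows "(\<lambda>k. real k * f k * charlier_weight b k) sums (b * s)"
proof -
  have "(\<lambda>k. real (Suc k) * f (Suc k) * charlier_weight b (Suc k)) =
        (\<lambda>k. b * (f (Suc k) * charlier_weight b k))"
    by (rule ext) (simp add: charlier_weight_eq divide_simps del: of_nat_Suc)
  with sums_mult[OF assms, of b]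
  have "(\<lambda>k. real (Suc k) * f (Suc k) * charlier_weight b (Suc k)) sums (b * s)"
    by simp
  thus ?thesis by (subst (asm) sums_Suc_iff) simp
qed

lemma pochhammer_uminus_Suc:
  "pochhammer (- real (Suc k)) (Suc l) = - real (Suc k) * pochhammer (- real k) l"
  by (simp add: pochhammer_rec algebra_simps)

text \<open>Splitting off the first factor of the Pochhammer symbol and absorbing it into the weight
  trades one Pochhammer index for a shift of the argument of \<open>f\<close>. This recursion drives
  both moment computations below.\<close>

lemma sums_pochhammer_Suc:
  assumes "(\<lambda>k. pochhammer (- real k) i * f (Suc k) * charlier_weight b k) sums s"
  shows "(\<lambda>k. pochhammer (- real k) (Suc i) * f k * charlier_weight b k) sums (- (b * s))"
proof -
  \<comment> \<open>The truncated value of \<open>k - 1\<close> at \<open>k = 0\<close> is harmless,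
    because \<open>g\<close> is only used with the factor \<open>k\<close> in front.\<close>
  define g where "g k = pochhammer (- real (k - 1)) i * f k" for k
  have "(\<lambda>k. real k * g k * charlier_weight b k) sums (b * s)"
    by (rule sums_charlier_weight_shift) (use assms in \<open>simp add: g_def\<close>)
  from sums_minus[OF this] show ?thesis
  proof (rule sums_cong[THEN iffD1, rotated])
    fix k show "- (real k * g k * charlier_weight b k) =
      pochhammer (- real k) (Suc i) * f k * charlier_weight b k"
      by (cases k) (simp_all add: g_def pochhammer_uminus_Suc pochhammer_0_left del: of_nat_Suc)
  qed
qed

lemma pochhammer_moment:
  "(\<lambda>k. pochhammer (- real k) l * charlier_weight b k) sums ((- b) ^ l * exp b)"
proof (induction l)
  case 0
  show ?case using charlier_weight_sums by simp
next
  case (Suc l)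
  show ?case using sums_pochhammer_Suc[of l "\<lambda>_. 1" b] Suc by (simp add: mult.assoc)
qed

text \<open>
  The Charlier polynomials, scaled such that their generating function is
  \<open>\<Sum>\<^sub>j K\<^sub>j(x) u^j = exp(-u) (1 + u/b)^x\<close>.
\<close>
definition charlier_poly :: "real \<Rightarrow> nat \<Rightarrow> real poly" where
  "charlier_poly b j =
     (\<Sum>l\<le>j. smult ((-1) ^ j / (b ^ l * fact l * fact (j - l))) (pochhammer [:0, -1:] l))"

lemma poly_charlier_poly:
  "poly (charlier_poly b j) x =
     (\<Sum>l\<le>j. (-1) ^ j / (b ^ l * fact l * fact (j - l)) * pochhammer (- x) l)"
  by (simp add: charlier_poly_def poly_sum poly_pochhammer_uminus)

lemma charlier_poly_nonzero_degree:
  assumes "b \<noteq> 0"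
  shows "charlier_poly b j \<noteq> 0 \<and> degree (charlier_poly b j) = j"
proof -
  \<comment> \<open>Only the summand \<open>l = j\<close> reaches degree \<open>j\<close>; its sign
    cancels against the leading coefficient of the Pochhammer polynomial.\<close>
  have "coeff (charlier_poly b j) j = (\<Sum>l\<le>j. if l = j then 1 / (b ^ j * fact j) else 0)"
    unfolding charlier_poly_def coeff_sum
  proof (rule sum.cong)
    fix l assume "l \<in> {..j}"
    then show "coeff (smult ((-1) ^ j / (b ^ l * fact l * fact (j - l))) (pochhammer [:0, -1:] l)) j =
      (if l = j then 1 / (b ^ j * fact j) else 0)"
      using degree_lead_coeff_pochhammer_uminus[where ?'a = real, of l]
      by (auto simp: coeff_eq_0 simp flip: power_add)
  qed simp
  hence "coeff (charlier_poly b j) j \<noteq> 0" using assms by simp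
  moreover have "degree (charlier_poly b j) \<le> j"
    unfolding charlier_poly_def
    by (intro degree_sum_le) (auto intro!: order.trans[OF degree_smult_le]
      simp: degree_lead_coeff_pochhammer_uminus)
  ultimately show ?thesis using le_degree by fastforce
qed

text \<open>On the generating function, raising \<open>x\<close> by 1 is multiplication by
  \<open>1 + u/b\<close>. The proof takes forward differences of the Pochhammer symbols term by
  term.\<close>

lemma charlier_poly_shift:
  assumes "b \<noteq> 0"
  shows "poly (charlier_poly b (Suc j)) (x + 1) =
           poly (charlier_poly b (Suc j)) x + poly (charlier_poly b j) x / b"
proof -
  have diff: "pochhammer (- (x + 1)) (Suc l) - pochhammer (- x) (Suc l) = - real (Suc l) * pochhammer (- x) l"
    for l :: nat
  proof -
    have "- (x + 1) + 1 = - x" by simp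
    then show ?thesis
      by (simp only: pochhammer_rec[of "- (x + 1)"] pochhammer_Suc[of "- x"])
        (simp add: algebra_simps)
  qed
  have "poly (charlier_poly b (Suc j)) (x + 1) - poly (charlier_poly b (Suc j)) x =
    (\<Sum>l\<le>Suc j. (-1) ^ Suc j / (b ^ l * fact l * fact (Suc j - l)) *
       (pochhammer (- (x + 1)) l - pochhammer (- x) l))"
    by (simp only: poly_charlier_poly sum_subtractf right_diff_distrib)
  also have "\<dots> = (\<Sum>l\<le>j. (-1) ^ Suc j / (b ^ Suc l * fact (Suc l) * fact (j - l)) *
       (- real (Suc l) * pochhammer (- x) l))"
    by (simp only: sum.atMost_Suc_shift diff) simp
  also have "\<dots> = poly (charlier_poly b j) x / b"
    unfolding poly_charlier_poly sum_divide_distrib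
    using assms by (intro sum.cong) (simp_all add: divide_simps del: of_nat_Suc)
  finally show ?thesis by simp
qed

text \<open>The factorial moments reduce the sum to the alternating sum of a row of binomial
  coefficients, which vanishes unless \<open>j = 0\<close>.\<close>

lemma charlier_poly_sums:
  assumes "b \<noteq> 0"
  shows "(\<lambda>k. poly (charlier_poly b j) (real k) * charlier_weight b k) sums (if j = 0 then exp b else 0)"
proof -
  have "(\<lambda>k. \<Sum>l\<le>j. (-1) ^ j / (b ^ l * fact l * fact (j - l)) *
           (pochhammer (- real k) l * charlier_weight b k)) sums
        (\<Sum>l\<le>j. (-1) ^ j / (b ^ l * fact l * fact (j - l)) * ((- b) ^ l * exp b))"
    by (intro sums_sum sums_mult pochhammer_moment)
  also have "(\<Sum>l\<le>j. (-1) ^ j / (b ^ l * fact l * fact (j - l)) * ((- b) ^ l * exp b)) =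
    (-1) ^ j / fact j * exp b * (\<Sum>l\<le>j. (-1) ^ l * of_nat (j choose l))"
    unfolding sum_distrib_left using assms
    by (intro sum.cong) (simp_all add: binomial_fact power_minus[of b] divide_simps)
  also have "(\<Sum>l\<le>j. (-1) ^ l * real (j choose l)) = (if j = 0 then 1 else 0)"
    using choose_alternating_sum[of j, where ?'a = real] by auto
  finally show ?thesis
    by (auto simp: poly_charlier_poly sum_distrib_right mult.assoc)
qed

text \<open>Induction on \<open>i\<close> for all \<open>j\<close> at once:
  \<open>sums_pochhammer_Suc\<close> lowers \<open>i\<close> at the price of a shifted argument, and
  \<open>charlier_poly_shift\<close> resolves the shift into the indices \<open>j\<close> and
  \<open>j - 1\<close>.\<close>

lemma charlier_poly_moment:
  assumes "b \<noteq> 0"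
  shows "(\<lambda>k. pochhammer (- real k) i * poly (charlier_poly b j) (real k) * charlier_weight b k)
           sums ((-1) ^ i * exp b * real (i choose j) * b ^ (i - j))"
proof (induction i arbitrary: j)
  case 0
  show ?case using charlier_poly_sums[OF assms, of j] by (cases j) auto
next
  case (Suc i)
  show ?case
  proof (cases j)
    case 0
    have "poly (charlier_poly b 0) x = 1" for x by (simp add: poly_charlier_poly)
    with 0 show ?thesis
      using pochhammer_moment[of "Suc i" b] by (simp add: power_minus[of b] mult_ac)
  next
    case (Suc j')
    \<comment> \<open>Pascal's rule; the case split is due to the truncated exponent
      \<open>i - Suc j'\<close>.\<close>
    have eq: "(-1) ^ i * exp b * real (i choose Suc j') * b ^ (i - Suc j') +
              (-1) ^ i * exp b * real (i choose j') * b ^ (i - j') / b =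
              - ((-1) ^ Suc i * exp b * real (Suc i choose Suc j') * b ^ (Suc i - Suc j')) / b"
      (is "?S = _")
    proof (cases "i \<le> j'")
      case True
      then show ?thesis using assms by (simp add: binomial_eq_0)
    next
      case False
      then have "i - j' = Suc (i - Suc j')" by simp
      then show ?thesis using assms by (simp add: field_simps)
    qed
    have "(\<lambda>k. pochhammer (- real k) i * poly (charlier_poly b j) (real (Suc k)) * charlier_weight b k) sums ?S"
      using sums_add[OF Suc.IH[of "Suc j'"] sums_divide[OF Suc.IH[of j'], of b]] Suc
        charlier_poly_shift[OF assms, of j' "real k" for k]
      by (simp add: algebra_simps)
    from sums_pochhammer_Suc[where f = "\<lambda>k. poly (charlier_poly b j) (real k)", OF this]
    show ?thesis unfolding eq using Suc assms by simp
  qed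
qed

subsection \<open>The Hermite-Pade problem for two exponentials\<close>

unbundle no vec_syntax and fps_syntax

text \<open>The operator \<open>D - c\<close>, that is, \<open>D\<close> conjugated by
  \<open>exp(c t)\<close>; hence its \<open>m\<close>-th power annihilates
  \<open>p(t) exp(c t)\<close> for polynomials \<open>p\<close> of degree below
  \<open>m\<close>.\<close>

definition fps_twisted_deriv :: "'a::comm_ring_1 \<Rightarrow> 'a fps \<Rightarrow> 'a fps" where
  "fps_twisted_deriv c F = fps_deriv F - fps_const c * F"

lemma fps_twisted_deriv_nth:
  "fps_twisted_deriv c F $ i = of_nat (Suc i) * F $ Suc i - c * F $ i"
  by (simp add: fps_twisted_deriv_def)

lemma funpow_fps_twisted_deriv_add:
  "(fps_twisted_deriv c ^^ m) (F + G) = (fps_twisted_deriv c ^^ m) F + (fps_twisted_deriv c ^^ m) G"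
  by (induction m) (simp_all add: fps_twisted_deriv_def algebra_simps)

lemma funpow_fps_twisted_deriv_mult_exp:
  fixes a c :: "'a :: field_char_0"
  shows "(fps_twisted_deriv c ^^ m) (F * fps_exp a) = (fps_twisted_deriv (c - a) ^^ m) F * fps_exp a"
  by (induction m)
    (simp_all add: fps_twisted_deriv_def fps_const_sub[symmetric] algebra_simps del: fps_const_sub)

lemma funpow_fps_twisted_deriv_nth_eq_0:
  assumes "\<And>i. i \<ge> n \<Longrightarrow> F $ i = 0" and "i \<ge> n"
  shows "(fps_twisted_deriv c ^^ m) F $ i = 0"
  using assms(2) by (induction m arbitrary: i) (simp_all add: assms(1) fps_twisted_deriv_nth)

lemma funpow_fps_deriv_eq_0:
  assumes "\<And>i. i \<ge> m \<Longrightarrow> F $ i = 0"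
  shows "(fps_twisted_deriv 0 ^^ m) F = 0"
  using assms
proof (induction m arbitrary: F)
  case 0
  then show ?case by (simp add: fps_eq_iff)
next
  case (Suc m)
  then show ?case by (simp add: funpow_Suc_right fps_twisted_deriv_nth del: funpow.simps)
qed

text \<open>Each application lowers the order of vanishing by one: \<open>D\<close> sends
  \<open>t^(r+1)/(r+1)!\<close> to \<open>t^r/r!\<close>, while the term with \<open>c\<close> only
  affects higher orders.\<close>

lemma funpow_fps_twisted_deriv_leading:
  fixes c :: "'a :: field_char_0"
  assumes "\<And>i. i \<le> M + m \<Longrightarrow> F $ i = (if i = M + m then 1 / fact (M + m) else 0)" and "i \<le> M"
  shows "(fps_twisted_deriv c ^^ m) F $ i = (if i = M then 1 / fact M else 0)"
  using assms
proof (induction m arbitrary: F)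
  case (Suc m)
  have "(fps_twisted_deriv c ^^ m) (fps_twisted_deriv c F) $ i = (if i = M then 1 / fact M else 0)"
  proof (rule Suc.IH)
    fix i assume "i \<le> M + m"
    then show "fps_twisted_deriv c F $ i = (if i = M + m then 1 / fact (M + m) else 0)"
      using Suc.prems(1)[of i] Suc.prems(1)[of "Suc i"]
      by (auto simp: fps_twisted_deriv_nth divide_simps simp del: of_nat_Suc)
  qed fact
  then show ?case by (simp add: funpow_Suc_right del: funpow.simps)
qed simp

text \<open>Multiplying by \<open>fps_exp (- a)\<close>, which has constant term 1, preserves the
  leading term; the degree bound on \<open>H\<close> excludes everything beyond it.\<close>

lemma fps_mult_exp_leading_unique:
  fixes a :: "'a :: field_char_0"
  assumes "\<And>i. i \<le> M \<Longrightarrow> (H * fps_exp a) $ i = (if i = M then t else 0)"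
    and "\<And>i. i > M \<Longrightarrow> H $ i = 0"
  shows "H $ i = (if i = M then t else 0)"
proof (cases "i \<le> M")
  case True
  have "fps_exp a * fps_exp (- a) = 1"
    using fps_exp_add_mult[of a "- a"] by simp
  then have "H = H * fps_exp a * fps_exp (- a)"
    by (simp add: mult.assoc)
  then have "H $ i = (H * fps_exp a * fps_exp (- a)) $ i" by (rule arg_cong)
  also have "\<dots> = (\<Sum>j=0..i. (H * fps_exp a) $ j * fps_exp (- a) $ (i - j))"
    by (rule fps_mult_nth)
  also have "\<dots> = (\<Sum>j=0..i. if j = M then t * fps_exp (- a) $ (i - j) else 0)"
    using True assms(1) by (intro sum.cong) auto
  also have "\<dots> = (if i = M then t else 0)"
    using True by (auto simp: sum.delta)
  finally show ?thesis .
qed (use assms(2) in auto)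

text \<open>
  The coefficients of \<open>(u + d)\<^sup>-\<^sup>m\<close> as a power series in \<open>u\<close>. Truncated subtraction gives the
  intended value 1 for \<open>m = i = 0\<close>.
\<close>
definition inverse_power_coeff :: "'a::field \<Rightarrow> nat \<Rightarrow> nat \<Rightarrow> 'a" where
  "inverse_power_coeff d m i = (-1) ^ i * of_nat ((m + i - 1) choose i) / d ^ (m + i)"

text \<open>This lemma and the next compare coefficients in
  \<open>(u + d) (u + d)^(-(m+1)) = (u + d)^(-m)\<close>.\<close>

lemma inverse_power_coeff_Suc_0:
  "d \<noteq> 0 \<Longrightarrow> d * inverse_power_coeff d (Suc m) 0 = inverse_power_coeff d m 0"
  by (simp add: inverse_power_coeff_def)

lemma inverse_power_coeff_Suc_Suc:
  "d \<noteq> 0 \<Longrightarrow> inverse_power_coeff d (Suc m) i + d * inverse_power_coeff d (Suc m) (Suc i) =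
     inverse_power_coeff d m (Suc i)"
  by (simp add: inverse_power_coeff_def field_simps)

text \<open>Formally \<open>A = (D + d)^(-m) t^M/M!\<close>, where the series in \<open>D\<close>
  terminates and \<open>D^i\<close> sends \<open>t^M/M!\<close> to \<open>t^(M-i)/(M-i)!\<close>.
  The induction on \<open>m\<close> inverts one factor \<open>D + d\<close> at a time.\<close>

lemma funpow_fps_twisted_deriv_solve:
  fixes d :: "'a :: field_char_0"
  assumes "d \<noteq> 0" and "\<And>i. i > M \<Longrightarrow> A $ i = 0"
    and "\<And>i. i \<le> M \<Longrightarrow> (fps_twisted_deriv (- d) ^^ m) A $ i = (if i = M then 1 / fact M else 0)"
    and "j \<le> M"
  shows "A $ j = inverse_power_coeff d m (M - j) / fact j"
  using assms(2-)
proof (induction m arbitrary: A j)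
  case 0
  then show ?case by (auto simp: inverse_power_coeff_def binomial_eq_0)
next
  case (Suc m)
  have IH: "of_nat (Suc i) * A $ Suc i + d * A $ i = inverse_power_coeff d m (M - i) / fact i"
    if "i \<le> M" for i
  proof -
    have "fps_twisted_deriv (- d) A $ i = inverse_power_coeff d m (M - i) / fact i"
      using Suc.prems that
      by (intro Suc.IH) (simp_all add: fps_twisted_deriv_nth funpow_Suc_right del: funpow.simps)
    then show ?thesis by (simp add: fps_twisted_deriv_nth del: of_nat_Suc)
  qed
  \<comment> \<open>Downward induction from \<open>M\<close>, where \<open>A $ Suc M = 0\<close>
    leaves an equation for \<open>A $ M\<close> alone; each step divides by
    \<open>d\<close>.\<close>
  from Suc.prems(3) show ?case
  proof (induction j rule: inc_induct)
    case base
    have "d * A $ M = d * (inverse_power_coeff d (Suc m) 0 / fact M)"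
      using IH[of M] Suc.prems(1)[of "Suc M"] inverse_power_coeff_Suc_0[OF assms(1), of m] by simp
    with assms(1) show ?case by (metis diff_self_eq_0 mult_left_cancel)
  next
    case (step j)
    define i where "i = M - Suc j"
    have i: "M - j = Suc i" "M - Suc j = i" using step.hyps by (simp_all add: i_def)
    have "of_nat (Suc j) * A $ Suc j = inverse_power_coeff d (Suc m) i / fact j"
      using step.IH by (simp add: i field_simps del: of_nat_Suc)
    then have "d * A $ j = inverse_power_coeff d m (Suc i) / fact j - inverse_power_coeff d (Suc m) i / fact j"
      using IH[of j] step.hyps by (simp add: i eq_diff_eq add.commute del: of_nat_Suc)
    also have "\<dots> = d * (inverse_power_coeff d (Suc m) (Suc i) / fact j)"
      using inverse_power_coeff_Suc_Suc[OF assms(1), of m i, symmetric]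
      by (simp add: add_divide_distrib)
    finally show ?case using assms(1) unfolding i by (metis mult_left_cancel)
  qed
qed

subsection \<open>The type I polynomials\<close>

text \<open>Writing the binomial coefficient as a quotient of factorials turns the linear
  combination of moments into a Cauchy product.\<close>

lemma charlier_poly_combination_moment:
  assumes "b \<noteq> 0"
  shows "(\<lambda>k. pochhammer (- real k) i * poly (\<Sum>j<n. smult (c j) (charlier_poly b j)) (real k) *
             charlier_weight b k) sums
           ((-1) ^ i * fact i *
             (Abs_fps (\<lambda>j. if j < n then exp b * c j / fact j else 0) * fps_exp b) $ i)"
    (is "?f sums (_ * (?A * _) $ i)")
proof -
  have "(\<lambda>k. \<Sum>j<n. c j * (pochhammer (- real k) i * poly (charlier_poly b j) (real k) * charlier_weight b k))
     sums (\<Sum>j<n. c j * ((-1) ^ i * exp b * real (i choose j) * b ^ (i - j)))" (is "_ sums ?s")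
    by (intro sums_sum sums_mult charlier_poly_moment assms)
  also have "?s = (\<Sum>j\<in>{0..i} \<inter> {..<n}. c j * ((-1) ^ i * exp b * real (i choose j) * b ^ (i - j)))"
    by (rule sum.mono_neutral_right) (auto simp: binomial_eq_0)
  also have "\<dots> = (\<Sum>j\<in>{0..i} \<inter> {..<n}. (-1) ^ i * fact i * (?A $ j * fps_exp b $ (i - j)))"
    by (intro sum.cong) (auto simp: binomial_fact)
  also have "\<dots> = (-1) ^ i * fact i * (\<Sum>j=0..i. ?A $ j * fps_exp b $ (i - j))"
    unfolding sum_distrib_left by (rule sum.mono_neutral_left) auto
  also have "(\<Sum>j=0..i. ?A $ j * fps_exp b $ (i - j)) = (?A * fps_exp b) $ i"
    by (rule fps_mult_nth[symmetric])
  finally show ?thesis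
    by (simp add: poly_sum sum_distrib_left sum_distrib_right mult_ac)
qed

text \<open>Secures convergence of the top moment, so that its value can be read off from the
  normalization.\<close>

lemma summable_poly_charlier_weight:
  assumes "b \<noteq> 0"
  shows "summable (\<lambda>k. pochhammer (- real k) i * poly P (real k) * charlier_weight b k)"
proof -
  obtain c where "P = (\<Sum>j<Suc (degree P). smult (c j) (charlier_poly b j))"
    using poly_expand_in_graded_basis[of "charlier_poly b" P "Suc (degree P)"]
      charlier_poly_nonzero_degree[OF assms] by auto
  then show ?thesis
    using charlier_poly_combination_moment[OF assms, of i c "Suc (degree P)"]
    by (auto simp: summable_def)
qed

text \<open>Phrased with free parameters instead of the indices 1 and 2, so that exchanging the
  roles gives the other polynomial.\<close>

lemma type_I_first_poly:
  fixes b1 b2 :: real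
  assumes "b1 > 0" "b2 > 0" "b1 \<noteq> b2" and n1: "n1 \<ge> 1"
    and deg: "P1 = 0 \<or> degree P1 < n1" "P2 = 0 \<or> degree P2 < n2"
    and moments: "\<And>i. i < n1 + n2 \<Longrightarrow>
      (\<lambda>k. pochhammer (- real k) i *
         (poly P1 (real k) * charlier_weight b1 k + poly P2 (real k) * charlier_weight b2 k))
      sums (if i + 1 = n1 + n2 then (-1) ^ i else 0)"
  shows "P1 = (\<Sum>j<n1. smult (exp (- b1) * inverse_power_coeff (b1 - b2) n2 (n1 - 1 - j))
                         (charlier_poly b1 j))"
proof -
  have basis: "\<exists>c. P = (\<Sum>j<n. smult (c j) (charlier_poly b j))"
    if "b > 0" "P = 0 \<or> degree P < n" for b P n
    using that charlier_poly_nonzero_degree[of b]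
    by (intro poly_expand_in_graded_basis[where B = "charlier_poly b"]) auto
  obtain c1 where c1: "P1 = (\<Sum>j<n1. smult (c1 j) (charlier_poly b1 j))"
    using basis[OF assms(1) deg(1)] by blast
  obtain c2 where c2: "P2 = (\<Sum>j<n2. smult (c2 j) (charlier_poly b2 j))"
    using basis[OF assms(2) deg(2)] by blast
  define A1 where "A1 = Abs_fps (\<lambda>j. if j < n1 then exp b1 * c1 j / fact j else 0)"
  define A2 where "A2 = Abs_fps (\<lambda>j. if j < n2 then exp b2 * c2 j / fact j else 0)"
  define d where "d = b1 - b2"
  \<comment> \<open>The order \<open>n1 + n2 - 1\<close> prescribed for \<open>F\<close> equals
    \<open>M + n2\<close>, so \<open>n2\<close> applications of the operator leave order
    \<open>M\<close>, which is exactly the degree bound on \<open>A1\<close>.\<close>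
  define M where "M = n1 - 1"
  define F where "F = A1 * fps_exp b1 + A2 * fps_exp b2"
  define T where "T = (fps_twisted_deriv (- d) ^^ n2) A1"
  have d: "d \<noteq> 0" "b2 - b1 = - d" using assms(3) by (simp_all add: d_def)
  have F: "F $ i = (if i = M + n2 then 1 / fact (M + n2) else 0)" if "i \<le> M + n2" for i
  proof -
    have less: "i < n1 + n2" using that n1 by (simp add: M_def)
    have "(\<lambda>k. pochhammer (- real k) i *
         (poly P1 (real k) * charlier_weight b1 k + poly P2 (real k) * charlier_weight b2 k))
       sums ((-1) ^ i * fact i * F $ i)"
      using sums_add[OF charlier_poly_combination_moment[of b1 i c1 n1]
          charlier_poly_combination_moment[of b2 i c2 n2]] assms(1,2)
      by (simp add: F_def c1 c2 A1_def A2_def ring_distribs mult.assoc)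
    from sums_unique2[OF this moments[OF less]] show ?thesis
      using n1 by (auto simp: M_def field_simps split: if_splits)
  qed
  \<comment> \<open>On \<open>A2 * fps_exp b2\<close> the operator \<open>D - b2\<close> acts as a
    plain derivative of \<open>A2\<close>, which has degree below \<open>n2\<close>.\<close>
  have "(fps_twisted_deriv 0 ^^ n2) A2 = 0"
    by (rule funpow_fps_deriv_eq_0) (simp add: A2_def)
  then have "(fps_twisted_deriv b2 ^^ n2) F = T * fps_exp b1"
    by (simp add: F_def funpow_fps_twisted_deriv_add funpow_fps_twisted_deriv_mult_exp T_def d)
  then have "(T * fps_exp b1) $ i = (if i = M then 1 / fact M else 0)" if "i \<le> M" for i
    using funpow_fps_twisted_deriv_leading[OF F that, of b2] by simp
  moreover have A1: "A1 $ i = 0" if "i > M" for i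
    using that n1 by (simp add: A1_def M_def)
  moreover from this have "T $ i = 0" if "i > M" for i
    unfolding T_def using that
    by (intro funpow_fps_twisted_deriv_nth_eq_0[where n = "Suc M"]) auto
  ultimately have "T $ i = (if i = M then 1 / fact M else 0)" for i
    using fps_mult_exp_leading_unique by blast
  then have coeffs: "A1 $ j = inverse_power_coeff d n2 (M - j) / fact j" if "j \<le> M" for j
    using funpow_fps_twisted_deriv_solve[OF d(1) A1 _ that, of n2] by (simp add: T_def)
  have "exp b1 * c1 j = inverse_power_coeff d n2 (n1 - 1 - j)" if "j < n1" for j
    using coeffs[of j] that n1 by (simp add: A1_def M_def)
  then have "c1 j = exp (- b1) * inverse_power_coeff d n2 (n1 - 1 - j)" if "j < n1" for j
    using that by (simp add: exp_minus field_simps)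
  then show ?thesis unfolding c1 d_def by (intro sum.cong) simp_all
qed

text \<open>
  The top moment comes from the normalization against the type II polynomial of index
  \<open>(n\<^sub>1 + n\<^sub>2 - 1, 0)\<close>, of which only degree and leading coefficient matter.
\<close>
lemma charlier_type_I_moments:
  assumes CII: "charlier_type_II b (n 1 + n 2 - 1) 0 (CII (n 1 + n 2 - 1) 0)"
    and C: "charlier_type_I b CII n C" and i: "i < n 1 + n 2"
    and sm: "\<And>i. summable (\<lambda>k. pochhammer (- real k) i * type_I_form b C k)"
  shows "(\<lambda>k. pochhammer (- real k) i * type_I_form b C k)
           sums (if i + 1 = n 1 + n 2 then (-1) ^ i else 0)"
proof (cases "i + 1 = n 1 + n 2")
  case False
  with i C show ?thesis by (auto simp: charlier_type_I_def)
next
  case True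
  define P where "P = CII i 0"
  \<comment> \<open>The monic multiple of the Pochhammer polynomial. \<open>P - Q\<close> then has
    degree below \<open>i\<close>, so it expands in Pochhammer polynomials whose moments vanish, and
    only the top moment survives.\<close>
  define Q where "Q = smult ((-1) ^ i) (pochhammer [:0, -1 :: real:] i)"
  have "n 1 + n 2 - 1 = i" using True by simp
  then have P: "lead_coeff P = 1" "degree P = i"
    using CII by (auto simp: charlier_type_II_def P_def)
  have Q: "lead_coeff Q = 1" "degree Q = i"
    using degree_lead_coeff_pochhammer_uminus[where ?'a = real, of i]
    by (auto simp: Q_def simp flip: power_add)
  have "coeff (P - Q) j = 0" if "j \<ge> i" for j
    using that P Q by (cases "j = i") (auto simp: coeff_eq_0)
  then have "P - Q = 0 \<or> degree (P - Q) < i"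
    by (metis leading_coeff_0_iff not_le)
  moreover have "pochhammer [:0, -1 :: real:] j \<noteq> 0" for j
    using degree_lead_coeff_pochhammer_uminus[where ?'a = real, of j]
    by (metis leading_coeff_0_iff power_not_zero zero_neq_neg_one)
  ultimately obtain c where c: "P - Q = (\<Sum>j<i. smult (c j) (pochhammer [:0, -1:] j))"
    using poly_expand_in_graded_basis[of "\<lambda>j. pochhammer [:0, -1 :: real:] j" "P - Q" i]
      degree_lead_coeff_pochhammer_uminus by blast
  obtain s where s: "(\<lambda>k. pochhammer (- real k) i * type_I_form b C k) sums s"
    using sm unfolding summable_def by blast
  have "(\<lambda>k. (\<Sum>j<i. c j * (pochhammer (- real k) j * type_I_form b C k)) +
            (-1) ^ i * (pochhammer (- real k) i * type_I_form b C k))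
          sums ((\<Sum>j<i. c j * 0) + (-1) ^ i * s)"
    using C True s by (intro sums_add sums_sum sums_mult) (auto simp: charlier_type_I_def)
  also have "(\<lambda>k. (\<Sum>j<i. c j * (pochhammer (- real k) j * type_I_form b C k)) +
            (-1) ^ i * (pochhammer (- real k) i * type_I_form b C k)) =
          (\<lambda>k. poly P (real k) * type_I_form b C k)"
  proof
    fix k
    have "P = (\<Sum>j<i. smult (c j) (pochhammer [:0, -1:] j)) + Q"
      using c by (simp add: algebra_simps)
    then show "(\<Sum>j<i. c j * (pochhammer (- real k) j * type_I_form b C k)) +
            (-1) ^ i * (pochhammer (- real k) i * type_I_form b C k) =
          poly P (real k) * type_I_form b C k"
      by (simp add: Q_def poly_sum poly_pochhammer_uminus sum_distrib_left ring_distribs mult_ac add.commute)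
  qed
  finally have "(\<lambda>k. poly P (real k) * type_I_form b C k) sums ((-1) ^ i * s)" by simp
  moreover have "(\<lambda>k. poly P (real k) * type_I_form b C k) sums 1"
    using C True unfolding charlier_type_I_def P_def by force
  ultimately have "(-1) ^ i * s = 1" by (rule sums_unique2)
  then have "s = (-1) ^ i" by (auto simp: minus_one_power_iff split: if_splits)
  with s True show ?thesis by simp
qed

subsection \<open>Hypergeometric form\<close>

lemma pochhammer_uminus_of_nat:
  assumes "j \<le> M"
  shows "pochhammer (- of_nat M) j = ((-1) ^ j * fact M / fact (M - j) :: 'a :: field_char_0)"
  using assms
proof (induction j)
  case (Suc j)
  then obtain i where i: "M = j + Suc i" by (metis add_Suc_right add_Suc le_iff_add)
  have "pochhammer (- of_nat M) (Suc j) = (-1) ^ j * fact M / fact (Suc i) * (- of_nat (Suc i) :: 'a)"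
    using Suc by (simp add: pochhammer_Suc i)
  also have "\<dots> = (-1) ^ Suc j * fact M / fact (M - Suc j)"
    by (simp add: i fact_Suc[of i] del: of_nat_Suc fact_Suc)
  finally show ?case .
qed simp

text \<open>Summation along the diagonals \<open>l + m = j\<close>: the parameters in
  \<open>l + m\<close> come out, and the inner sum over \<open>l\<close> is a Charlier polynomial
  whose sign \<open>(-1)^j\<close> is absorbed by \<open>(- d)^j\<close>.\<close>

lemma double_sum_eq_charlier_poly:
  assumes "b \<noteq> 0"
  shows "(\<Sum>l = 0..M. \<Sum>m = 0..M - l.
            pochhammer (- real M) (l + m) * pochhammer (- x) l /
            (fact l * fact m * pochhammer \<alpha> (l + m)) * (d / b) ^ l * d ^ m) =
         (\<Sum>j\<le>M. pochhammer (- real M) j / pochhammer \<alpha> j * (- d) ^ j * poly (charlier_poly b j) x)"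
    (is "?lhs = _")
proof -
  define g where "g l m = pochhammer (- real M) (l + m) * pochhammer (- x) l /
            (fact l * fact m * pochhammer \<alpha> (l + m)) * (d / b) ^ l * d ^ m" for l m
  have "?lhs = (\<Sum>(l, m)\<in>(SIGMA l:{0..M}. {0..M - l}). g l m)"
    by (simp add: sum.Sigma g_def)
  also have "(SIGMA l:{0..M}. {0..M - l}) = {(l, m). l + m \<le> M}" by auto
  also have "(\<Sum>(l, m)\<in>{(l, m). l + m \<le> M}. g l m) = (\<Sum>j\<le>M. \<Sum>l\<le>j. g l (j - l))"
    by (rule sum.triangle_reindex_eq)
  also have "\<dots> = (\<Sum>j\<le>M. pochhammer (- real M) j / pochhammer \<alpha> j * (- d) ^ j * poly (charlier_poly b j) x)"
  proof (rule sum.cong[OF refl])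
    fix j
    show "(\<Sum>l\<le>j. g l (j - l)) =
      pochhammer (- real M) j / pochhammer \<alpha> j * (- d) ^ j * poly (charlier_poly b j) x"
      unfolding poly_charlier_poly sum_distrib_left
    proof (rule sum.cong[OF refl])
      fix l assume "l \<in> {..j}"
      then have "d ^ j = d ^ l * d ^ (j - l)" by (simp flip: power_add)
      moreover have "(-1) ^ j * (- d) ^ j = d ^ j" by (simp flip: power_mult_distrib)
      ultimately show "g l (j - l) = pochhammer (- real M) j / pochhammer \<alpha> j * (- d) ^ j *
         ((-1) ^ j / (b ^ l * fact l * fact (j - l)) * pochhammer (- x) l)"
        using \<open>l \<in> {..j}\<close> by (simp add: g_def power_divide mult_ac)
    qed
  qed
  finally show ?thesis .
qed

text \<open>The numerator symbol vanishes for \<open>l + m > M\<close>. As \<open>0 / 0 = 0\<close>,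
  this also holds where the denominator symbol vanishes.\<close>

lemma kampe_de_feriet_terminating:
  "kampe_de_feriet [- real M] [- x] [] [\<alpha>] [] [] u y =
     (\<Sum>l = 0..M. \<Sum>m = 0..M - l.
        pochhammer (- real M) (l + m) * pochhammer (- x) l /
        (fact l * fact m * pochhammer \<alpha> (l + m)) * u ^ l * y ^ m)"
proof -
  define g where "g l m = pochhammer (- real M) (l + m) * pochhammer (- x) l /
            (fact l * fact m * pochhammer \<alpha> (l + m)) * u ^ l * y ^ m" for l m
  have "kampe_de_feriet [- real M] [- x] [] [\<alpha>] [] [] u y = (\<Sum>\<^sub>\<infinity>(l, m)\<in>UNIV. g l m)"
    unfolding kampe_de_feriet_def
    by (intro infsum_cong) (auto simp: g_def pochhammers_def)
  also have "\<dots> = (\<Sum>\<^sub>\<infinity>(l, m)\<in>(SIGMA l:{0..M}. {0..M - l}). g l m)"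
  proof (rule infsum_cong_neutral)
    fix p assume "p \<in> UNIV - (SIGMA l:{0..M}. {0..M - l})"
    then have "M < fst p + snd p" by (cases p) auto
    then show "(case p of (l, m) \<Rightarrow> g l m) = 0"
      by (auto simp: g_def pochhammer_eq_0_iff split: prod.splits)
  qed auto
  also have "\<dots> = (\<Sum>(l, m)\<in>(SIGMA l:{0..M}. {0..M - l}). g l m)"
    by (rule infsum_finite) auto
  also have "\<dots> = (\<Sum>l = 0..M. \<Sum>m = 0..M - l. g l m)"
    by (simp add: sum.Sigma)
  finally show ?thesis by (simp add: g_def)
qed

text \<open>Both Pochhammer symbols are signed quotients of factorials; with
  \<open>M = i + j\<close> the factorials of \<open>M\<close> and \<open>M + M'\<close> cancel
  against the prefactor and a binomial coefficient remains.\<close>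

lemma type_I_coefficient:
  assumes "d \<noteq> (0 :: real)" "j \<le> M"
  shows "(-1) ^ M * fact (M + M') / (fact M * fact M') * (1 / d ^ (M + M' + 1)) *
           (pochhammer (- real M) j / pochhammer (- real (M + M')) j * (- d) ^ j) =
         inverse_power_coeff d (Suc M') (M - j)"
proof -
  obtain i where i: "M = i + j" using assms(2) by (metis le_add_diff_inverse2)
  have "pochhammer (- real M) j = (-1) ^ j * fact M / fact i"
    using pochhammer_uminus_of_nat[of j M, where ?'a = real] by (simp add: i)
  moreover have "pochhammer (- real (M + M')) j = (-1) ^ j * fact (M + M') / fact (i + M')"
    using pochhammer_uminus_of_nat[of j "M + M'", where ?'a = real] by (simp add: i)
  moreover have "inverse_power_coeff d (Suc M') (M - j) =
     (-1) ^ i * (fact (i + M') / (fact i * fact M')) / d ^ (Suc M' + i)"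
    by (simp add: inverse_power_coeff_def i binomial_fact add.commute)
  moreover have "d ^ (M + M' + 1) = d ^ j * d ^ (Suc M' + i)"
    by (simp add: i power_add)
  ultimately show ?thesis
    using assms(1) by (simp only: i power_minus[of d] power_add) (simp add: field_simps)
qed

section \<open>The limit for a vanishing second index\<close>

lemma Gamma_quotient:
  assumes \<nu>: "\<nu> \<noteq> 0" "\<bar>\<nu>\<bar> < 1" and j: "j \<le> M"
  shows "Gamma (real M + \<nu>) / Gamma \<nu> / pochhammer (- real M - \<nu> + 1) j =
           (-1) ^ j * pochhammer \<nu> (M - j)"
proof -
  have not_int: "\<nu> \<noteq> - real k" for k
    using \<nu> by (cases k) auto
  then have "\<nu> \<notin> \<int>\<^sub>\<le>\<^sub>0" by (auto elim!: nonpos_Ints_cases')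
  then have "Gamma (real M + \<nu>) / Gamma \<nu> = pochhammer \<nu> M"
    by (simp add: pochhammer_Gamma add.commute)
  also have "\<dots> = pochhammer \<nu> (M - j) * pochhammer (\<nu> + real (M - j)) j"
    using pochhammer_product'[of \<nu> "M - j" j] j by simp
  finally have quot: "Gamma (real M + \<nu>) / Gamma \<nu> = pochhammer \<nu> (M - j) * pochhammer (\<nu> + real (M - j)) j" .
  \<comment> \<open>Up to sign and order, the factors of the denominator symbol are the last
    \<open>j\<close> factors of \<open>pochhammer \<nu> M\<close>. Cancelling them leaves a
    polynomial in \<open>\<nu>\<close>.\<close>
  have "pochhammer (- real M - \<nu> + 1) j = pochhammer (- (real M + \<nu> - 1)) j" by (simp add: algebra_simps)
  also have "\<dots> = (-1) ^ j * pochhammer (\<nu> + real (M - j)) j"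
    unfolding pochhammer_minus using j by (simp add: of_nat_diff algebra_simps)
  finally have "pochhammer (- real M - \<nu> + 1) j = (-1) ^ j * pochhammer (\<nu> + real (M - j)) j" .
  moreover have "pochhammer (\<nu> + real (M - j)) j \<noteq> 0"
    using not_int[of "M - j + k" for k] by (auto simp: pochhammer_eq_0_iff)
      (metis add_diff_cancel_right' diff_minus_eq_add minus_add_distrib uminus_add_conv_diff)
  ultimately show ?thesis using quot by (simp add: field_simps)
qed

text \<open>Near 0, but not at 0, the expression agrees with the polynomial \<open>g\<close> in
  \<open>\<nu>\<close>. At 0 only \<open>j = M\<close> survives in \<open>g\<close>, since
  \<open>pochhammer 0 (M - j) = 0\<close> otherwise.\<close>

lemma type_I_degenerate_limit:
  assumes "d \<noteq> (0 :: real)"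
  shows "((\<lambda>\<nu>. (-1) ^ M * Gamma (real M + \<nu>) / (fact M * Gamma \<nu>) * (e / d ^ M) *
            (\<Sum>j\<le>M. pochhammer (- real M) j / pochhammer (- real M - \<nu> + 1) j * (- d) ^ j * f j))
          \<longlongrightarrow> e * f M) (at 0)"
proof -
  define g where "g \<nu> = (-1) ^ M / fact M * (e / d ^ M) *
    (\<Sum>j\<le>M. pochhammer (- real M) j * pochhammer \<nu> (M - j) * d ^ j * f j)" for \<nu>
  have "continuous_on UNIV g"
    unfolding g_def by (intro continuous_intros)
  then have "(g \<longlongrightarrow> g 0) (at 0)"
    by (simp add: continuous_on_def)
  also have "g 0 = e * f M"
  proof -
    have "(\<Sum>j\<le>M. pochhammer (- real M) j * pochhammer 0 (M - j) * d ^ j * f j) =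
          (\<Sum>j\<le>M. if j = M then pochhammer (- real M) M * d ^ M * f M else 0)"
      by (intro sum.cong) (auto simp: pochhammer_0_left)
    also have "\<dots> = (-1) ^ M * fact M * d ^ M * f M"
      by (simp add: pochhammer_same)
    finally show ?thesis using assms by (simp add: g_def flip: power_add)
  qed
  finally have "(g \<longlongrightarrow> e * f M) (at 0)" .
  moreover have "eventually (\<lambda>\<nu>::real. \<nu> \<noteq> 0 \<and> \<bar>\<nu>\<bar> < 1) (at 0)"
    by (auto simp: eventually_at dist_real_def intro!: exI[of _ 1])
  then have "eventually (\<lambda>\<nu>. g \<nu> = (-1) ^ M * Gamma (real M + \<nu>) / (fact M * Gamma \<nu>) * (e / d ^ M) *
       (\<Sum>j\<le>M. pochhammer (- real M) j / pochhammer (- real M - \<nu> + 1) j * (- d) ^ j * f j)) (at 0)"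
  proof eventually_elim
    case (elim \<nu>)
    have "pochhammer (- real M) j * pochhammer \<nu> (M - j) * d ^ j * f j =
      Gamma (real M + \<nu>) / Gamma \<nu> *
      (pochhammer (- real M) j / pochhammer (- real M - \<nu> + 1) j * (- d) ^ j * f j)" if "j \<le> M" for j
    proof -
      have "Gamma (real M + \<nu>) / Gamma \<nu> *
          (pochhammer (- real M) j / pochhammer (- real M - \<nu> + 1) j * (- d) ^ j * f j) =
        Gamma (real M + \<nu>) / Gamma \<nu> / pochhammer (- real M - \<nu> + 1) j *
          (pochhammer (- real M) j * (- d) ^ j * f j)" by simp
      also have "\<dots> = pochhammer (- real M) j * pochhammer \<nu> (M - j) * d ^ j * f j"
        using Gamma_quotient[of \<nu> j M] elim that by (simp add: power_minus[of d])
      finally show ?thesis by simp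
    qed
    then have "(\<Sum>j\<le>M. pochhammer (- real M) j * pochhammer \<nu> (M - j) * d ^ j * f j) =
      Gamma (real M + \<nu>) / Gamma \<nu> *
      (\<Sum>j\<le>M. pochhammer (- real M) j / pochhammer (- real M - \<nu> + 1) j * (- d) ^ j * f j)"
      unfolding sum_distrib_left by (intro sum.cong) simp_all
    then show ?case by (simp add: g_def mult_ac)
  qed
  ultimately show ?thesis by (rule Lim_transform_eventually)
qed

theorem proposition9p1:
  fixes b :: "nat \<Rightarrow> real"
    and n :: "nat \<Rightarrow> nat"
    and CII :: "nat \<Rightarrow> nat \<Rightarrow> real poly"
    and C :: "nat \<Rightarrow> real poly"
  assumes "b 1 > 0" and "b 2 > 0" and "b 1 \<noteq> b 2"
    and "\<And>m1 m2. charlier_type_II b m1 m2 (CII m1 m2)"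
    and "charlier_type_I b CII n C"
  shows "\<forall>a\<in>{1, 2}. \<forall>x::real.
    (n 1 \<ge> 1 \<and> n 2 \<ge> 1 \<longrightarrow>
       poly (C a) x =
         (-1) ^ (n a - 1) * fact (n 1 + n 2 - 2) / (fact (n 1 - 1) * fact (n 2 - 1)) *
         (exp (- b a) / (b a - b (hat a)) ^ (n 1 + n 2 - 1)) *
         kampe_de_feriet [- real (n a) + 1] [- x] [] [- real (n 1) - real (n 2) + 2] [] []
           ((b a - b (hat a)) / b a) (b a - b (hat a)) \<and>
       poly (C a) x =
         (-1) ^ (n a - 1) * fact (n 1 + n 2 - 2) / (fact (n 1 - 1) * fact (n 2 - 1)) *
         (exp (- b a) / (b a - b (hat a)) ^ (n 1 + n 2 - 1)) *
         (\<Sum>l = 0..n a - 1. \<Sum>m = 0..n a - 1 - l.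
            pochhammer (- real (n a) + 1) (l + m) * pochhammer (- x) l /
            (fact l * fact m * pochhammer (- real (n 1) - real (n 2) + 2) (l + m)) *
            ((b a - b (hat a)) / b a) ^ l * (b a - b (hat a)) ^ m)) \<and>
    \<comment> \<open>if n a = 0, the right-hand sides are 0 because of the factor 1 / (n a - 1)!\<close>
    (n a = 0 \<longrightarrow> poly (C a) x = 0) \<and>
    \<comment> \<open>if only the other index is 0, the right-hand sides are indeterminate (1 / (-1)! = 0 against
        a zero denominator) and denote their limits as that index, called \<nu>, tends to 0\<close>
    (n a \<ge> 1 \<and> n (hat a) = 0 \<longrightarrow>
       ((\<lambda>\<nu>::real.
         (-1) ^ (n a - 1) * Gamma (real (n a) + \<nu> - 1) / (fact (n a - 1) * Gamma \<nu>) *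
         (exp (- b a) / (b a - b (hat a)) ^ (n a - 1)) *
         kampe_de_feriet [- real (n a) + 1] [- x] [] [- real (n a) - \<nu> + 2] [] []
           ((b a - b (hat a)) / b a) (b a - b (hat a)))
         \<longlongrightarrow> poly (C a) x) (at 0) \<and>
       ((\<lambda>\<nu>::real.
         (-1) ^ (n a - 1) * Gamma (real (n a) + \<nu> - 1) / (fact (n a - 1) * Gamma \<nu>) *
         (exp (- b a) / (b a - b (hat a)) ^ (n a - 1)) *
         (\<Sum>l = 0..n a - 1. \<Sum>m = 0..n a - 1 - l.
            pochhammer (- real (n a) + 1) (l + m) * pochhammer (- x) l /
            (fact l * fact m * pochhammer (- real (n a) - \<nu> + 2) (l + m)) *
            ((b a - b (hat a)) / b a) ^ l * (b a - b (hat a)) ^ m))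
         \<longlongrightarrow> poly (C a) x) (at 0))"
proof -
  have result: "C a = (\<Sum>j<n a. smult (exp (- b a) * inverse_power_coeff (b a - b (hat a)) (n (hat a)) (n a - 1 - j))
                          (charlier_poly (b a) j))"
    if a: "a \<in> {1, 2}" and na: "n a \<ge> 1" for a
  proof -
    have deg: "C c = 0 \<or> degree (C c) < n c" if "c \<in> {1, 2}" for c
      using assms(5) that by (auto simp: charlier_type_I_def)
    have moments: "(\<lambda>k. pochhammer (- real k) i * type_I_form b C k)
        sums (if i + 1 = n 1 + n 2 then (-1) ^ i else 0)" if "i < n 1 + n 2" for i
    proof (rule charlier_type_I_moments[OF assms(4) assms(5) that])
      fix i
      show "summable (\<lambda>k. pochhammer (- real k) i * type_I_form b C k)"
        using summable_add[OF summable_poly_charlier_weight[of "b 1" i "C 1"]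
            summable_poly_charlier_weight[of "b 2" i "C 2"]] assms(1,2)
        by (simp add: type_I_form_def ring_distribs mult.assoc)
    qed
    show ?thesis
    \<comment> \<open>For \<open>a = 2\<close> the two summands of the type I form are
      exchanged.\<close>
    proof (rule type_I_first_poly)
      show "(\<lambda>k. pochhammer (- real k) i * (poly (C a) (real k) * charlier_weight (b a) k +
            poly (C (hat a)) (real k) * charlier_weight (b (hat a)) k))
          sums (if i + 1 = n a + n (hat a) then (-1) ^ i else 0)" if "i < n a + n (hat a)" for i
        using a moments[of i] that
        by (auto simp: hat_def type_I_form_def add.commute)
    qed (use a na assms(1-3) deg in \<open>auto simp: hat_def\<close>)
  qed
  show ?thesis
  proof (intro ballI allI conjI impI; (elim conjE)?)
    fix a x
    assume a: "a \<in> {1::nat, 2}"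
    define M where "M = n a - 1"
    define d where "d = b a - b (hat a)"
    have pos: "b a \<noteq> 0" and d: "d \<noteq> 0"
      using a assms(1-3) by (auto simp: d_def hat_def)
    \<comment> \<open>These rewrite the series and the double sum to the same single sum over
      Charlier polynomials, so that one identity settles both claims of each case.\<close>
    note sums = kampe_de_feriet_terminating double_sum_eq_charlier_poly[OF pos]
    have closed_form: "poly (C a) x = exp (- b a) *
        (\<Sum>j\<le>M. inverse_power_coeff d (n (hat a)) (M - j) * poly (charlier_poly (b a) j) x)"
      if "n a \<ge> 1"
    proof -
      have "{..<n a} = {..M}" using that by (auto simp: M_def)
      then show ?thesis
        using result[OF a that] by (simp add: poly_sum M_def d_def sum_distrib_left mult.assoc)
    qed
    {
      assume n: "n 1 \<ge> 1" "n 2 \<ge> 1"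
      define M' where "M' = n (hat a) - 1"
      have na: "n a = Suc M" "n (hat a) = Suc M'"
        using a n by (auto simp: M_def M'_def hat_def)
      have exps: "n 1 + n 2 - 2 = M + M'" "n 1 + n 2 - 1 = M + M' + 1"
          "- real (n 1) - real (n 2) + 2 = - real (M + M')" "- real (n a) + 1 = - real M"
          "(fact (n 1 - 1) * fact (n 2 - 1) :: real) = fact M * fact M'"
        using a na by (auto simp: hat_def)
      have "poly (C a) x = (-1) ^ M * fact (M + M') / (fact M * fact M') *
          (exp (- b a) / d ^ (M + M' + 1)) *
          (\<Sum>j\<le>M. pochhammer (- real M) j / pochhammer (- real (M + M')) j * (- d) ^ j *
             poly (charlier_poly (b a) j) x)"
        (is "_ = ?c * (exp (- b a) / ?p) * _")
      proof -
        have "inverse_power_coeff d (Suc M') (M - j) * y = ?c * (1 / ?p) *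
            (pochhammer (- real M) j / pochhammer (- real (M + M')) j * (- d) ^ j * y)"
          if "j \<le> M" for j y
          unfolding type_I_coefficient[OF d that, symmetric] by (simp only: mult.assoc)
        then have "poly (C a) x = exp (- b a) * (\<Sum>j\<le>M. ?c * (1 / ?p) *
            (pochhammer (- real M) j / pochhammer (- real (M + M')) j * (- d) ^ j *
             poly (charlier_poly (b a) j) x))"
          using closed_form by (simp only: na) simp
        then show ?thesis by (simp only: sum_distrib_left[symmetric]) (simp add: mult_ac)
      qed
      then show "poly (C a) x =
         (-1) ^ (n a - 1) * fact (n 1 + n 2 - 2) / (fact (n 1 - 1) * fact (n 2 - 1)) *
         (exp (- b a) / (b a - b (hat a)) ^ (n 1 + n 2 - 1)) *
         kampe_de_feriet [- real (n a) + 1] [- x] [] [- real (n 1) - real (n 2) + 2] [] []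
           ((b a - b (hat a)) / b a) (b a - b (hat a))"
        and "poly (C a) x =
         (-1) ^ (n a - 1) * fact (n 1 + n 2 - 2) / (fact (n 1 - 1) * fact (n 2 - 1)) *
         (exp (- b a) / (b a - b (hat a)) ^ (n 1 + n 2 - 1)) *
         (\<Sum>l = 0..n a - 1. \<Sum>m = 0..n a - 1 - l.
            pochhammer (- real (n a) + 1) (l + m) * pochhammer (- x) l /
            (fact l * fact m * pochhammer (- real (n 1) - real (n 2) + 2) (l + m)) *
            ((b a - b (hat a)) / b a) ^ l * (b a - b (hat a)) ^ m)"
        unfolding exps M_def[symmetric] d_def[symmetric] sums by blast+
    }
    show "poly (C a) x = 0" if "n a = 0"
      using assms(5) a that by (auto simp: charlier_type_I_def)
    {
      assume n: "1 \<le> n a" "n (hat a) = 0"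
      have exps: "- real (n a) + 1 = - real M" "real (n a) + \<nu> - 1 = real M + \<nu>"
          "- real (n a) - \<nu> + 2 = - real M - \<nu> + 1" for \<nu>
        using n by (simp_all add: M_def of_nat_diff)
      \<comment> \<open>For exponent 0 the binomial series is the constant 1:
        \<open>(i - 1) choose i\<close> is 0 for \<open>i > 0\<close>, and 1 for
        \<open>i = 0\<close> by truncated subtraction.\<close>
      have "(\<Sum>j\<le>M. inverse_power_coeff d 0 (M - j) * poly (charlier_poly (b a) j) x) =
          (\<Sum>j\<le>M. if j = M then poly (charlier_poly (b a) j) x else 0)"
        by (intro sum.cong) (auto simp: inverse_power_coeff_def binomial_eq_0)
      then have "poly (C a) x = exp (- b a) * poly (charlier_poly (b a) M) x"
        using closed_form n by simp
      then have "((\<lambda>\<nu>. (-1) ^ M * Gamma (real M + \<nu>) / (fact M * Gamma \<nu>) * (exp (- b a) / d ^ M) *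
            (\<Sum>j\<le>M. pochhammer (- real M) j / pochhammer (- real M - \<nu> + 1) j * (- d) ^ j *
               poly (charlier_poly (b a) j) x)) \<longlongrightarrow> poly (C a) x) (at 0)"
        using type_I_degenerate_limit[OF d] by simp
      then show "((\<lambda>\<nu>::real.
         (-1) ^ (n a - 1) * Gamma (real (n a) + \<nu> - 1) / (fact (n a - 1) * Gamma \<nu>) *
         (exp (- b a) / (b a - b (hat a)) ^ (n a - 1)) *
         kampe_de_feriet [- real (n a) + 1] [- x] [] [- real (n a) - \<nu> + 2] [] []
           ((b a - b (hat a)) / b a) (b a - b (hat a)))
         \<longlongrightarrow> poly (C a) x) (at 0)"
        and "((\<lambda>\<nu>::real.
         (-1) ^ (n a - 1) * Gamma (real (n a) + \<nu> - 1) / (fact (n a - 1) * Gamma \<nu>) *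
         (exp (- b a) / (b a - b (hat a)) ^ (n a - 1)) *
         (\<Sum>l = 0..n a - 1. \<Sum>m = 0..n a - 1 - l.
            pochhammer (- real (n a) + 1) (l + m) * pochhammer (- x) l /
            (fact l * fact m * pochhammer (- real (n a) - \<nu> + 2) (l + m)) *
            ((b a - b (hat a)) / b a) ^ l * (b a - b (hat a)) ^ m))
         \<longlongrightarrow> poly (C a) x) (at 0)"
        unfolding exps M_def[symmetric] d_def[symmetric] sums by blast+
    }
  qed
qed

end
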